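(* Let $n\ge 1$ and let $(h_{ij})_{0\le j\le i\le n-1}$ be the $h$-triangle of $\Delta_{\mathrm{Dyck}_n}$. For $0\le j\le i\le n-1$, \[ h_{ij}=\Big|\big\{\,w\in\mathrm{Dyck}_n^{\max} : |V(w)|=i\text{ and }\mathrm{suc}(w)=i-j\,\big\}\Big| . \]
   Context: A Dyck path of semilength $n$ is a word $w=w_1\cdots w_{2n}$ in $\{U,D\}$ with equally many $U$'s and $D$'s such that every prefix contains at least as many $U$'s as $D$'s; $\mathrm{Dyck}_n$ is the set of these. A valley of $w$ is an index $i$ with $w_i=D$, $w_{i+1}=U$, identified with its position $(i,y)$, where $y$ is the number of $U$'s minus the number of $D$'s in $w_1\cdots w_i$. $V(w)$ is the set of valley positions of $w$, and $\Delta_{\mathrm{Dyck}_n}=\{V(w):w\in\mathrm{Dyck}_n\}$, which is a simplicial complex. $\mathrm{Dyck}_n^{\max}$ is the set of $w\in\mathrm{Dyck}_n$ for which $V(w)$ is a maximal face of $\Delta_{\mathrm{Dyck}_n}$; equivalently, those $w$ having no factor (consecutive subword) $UUDD$. A valley $(x,y)\in V(w)$ is successive if $(x-2,y)\in V(w)\cup\{(0,0)\}$, and $\mathrm{suc}(w)$ is the number of successive valleys of $w$. For a simplicial complex $\Delta$, the degree of a face $\sigma$ is $\deg(\sigma)=\max\{|\tau| : \tau\in\Delta,\ \sigma\subseteq\tau\}$, and $f_{ij}$ is the number of faces $\sigma$ with $|\sigma|=j$ and $\deg(\sigma)=i$. The $h$-triangle $(h_{ij})_{0\le j\le i}$ is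 defined by $\sum_{0\le j\le i}h_{ij}x^iy^{i-j}=\sum_{0\le j\le i}f_{ij}x^i(y-1)^{i-j}$. *)

theory Defs
  imports "HOL-Computational_Algebra.Polynomial"
begin

datatype step = U | D

definition height :: "step list \<Rightarrow> int" where
  "height w = int (count_list w U) - int (count_list w D)"

definition Dyck :: "nat \<Rightarrow> step list set" where
  "Dyck n = {w. length w = 2 * n \<and> count_list w U = count_list w D \<and>
     (\<forall>k\<le>length w. count_list (take k w) D \<le> count_list (take k w) U)}"

(* The i-th letter (counting from 1) of w is w ! (i - 1).  Positions are pairs of integers so that
   the subtraction x - 2 below is not truncated. *)
definition valleys :: "step list \<Rightarrow> (int \<times> int) set" where
  "valleys w = {(int i, height (take i w)) | i.
     1 \<le> i \<and> i < length w \<and> w ! (i - 1) = D \<and> w ! i = U}"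

definition Dyck_complex :: "nat \<Rightarrow> (int \<times> int) set set" where
  "Dyck_complex n = valleys ` Dyck n"

definition maximal_face :: "'a set set \<Rightarrow> 'a set \<Rightarrow> bool" where
  "maximal_face \<Delta> \<sigma> \<longleftrightarrow> \<sigma> \<in> \<Delta> \<and> (\<forall>\<tau>\<in>\<Delta>. \<sigma> \<subseteq> \<tau> \<longrightarrow> \<tau> = \<sigma>)"

definition Dyck_max :: "nat \<Rightarrow> step list set" where
  "Dyck_max n = {w \<in> Dyck n. maximal_face (Dyck_complex n) (valleys w)}"

definition suc :: "step list \<Rightarrow> nat" where
  "suc w = card {(x, y) \<in> valleys w. (x - 2, y) \<in> valleys w \<union> {(0, 0)}}"

definition face_degree :: "'a set set \<Rightarrow> 'a set \<Rightarrow> nat" where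
  "face_degree \<Delta> \<sigma> = Max {card \<tau> | \<tau>. \<tau> \<in> \<Delta> \<and> \<sigma> \<subseteq> \<tau>}"

definition f_triangle :: "'a set set \<Rightarrow> nat \<Rightarrow> nat \<Rightarrow> nat" where
  "f_triangle \<Delta> i j = card {\<sigma> \<in> \<Delta>. card \<sigma> = j \<and> face_degree \<Delta> \<sigma> = i}"

(* The maximal cardinality of a face, i.e. one more than the dimension; for a finite complex,
   f_triangle is zero for larger first index. *)
definition complex_rank :: "'a set set \<Rightarrow> nat" where
  "complex_rank \<Delta> = Max (card ` \<Delta>)"

(* Bivariate polynomials are polynomials in x over the polynomials in y. *)
definition x_var :: "int poly poly" where "x_var = [:0, 1:]"
definition y_var :: "int poly poly" where "y_var = [:[:0, 1:]:]"

(* Only the entries h i j with j <= i <= complex_rank are constrained; lemmas h_triangle_exists and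
   h_triangle_unique below show that these are uniquely determined. *)
definition is_h_triangle :: "'a set set \<Rightarrow> (nat \<Rightarrow> nat \<Rightarrow> int) \<Rightarrow> bool" where
  "is_h_triangle \<Delta> h \<longleftrightarrow>
     (\<Sum>i\<le>complex_rank \<Delta>. \<Sum>j\<le>i. of_int (h i j) * x_var ^ i * y_var ^ (i - j)) =
     (\<Sum>i\<le>complex_rank \<Delta>. \<Sum>j\<le>i. of_nat (f_triangle \<Delta> i j) * x_var ^ i * (y_var - 1) ^ (i - j))"

lemma y_var_power: "y_var ^ k = [:monom 1 k:]"
  by (induction k) (auto simp: y_var_def monom_Suc one_pCons monom_0)

lemma x_var_power: "x_var ^ k = monom 1 k"
  by (induction k) (auto simp: x_var_def monom_Suc one_pCons monom_0 smult_monom)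

lemma h_term: "of_int a * x_var ^ i * y_var ^ k = monom (monom a k) i"
proof -
  have "of_int a * x_var ^ i * y_var ^ k = [:[:a:]:] * monom 1 i * [:monom 1 k:]"
    by (simp add: x_var_power y_var_power of_int_poly)
  also have "\<dots> = monom (monom a k) i"
    by (simp add: mult.commute[of _ "[:monom 1 k:]"] smult_monom)
  finally show ?thesis .
qed

lemma f_term:
  "of_nat a * x_var ^ i * (y_var - 1) ^ k = monom (of_nat a * [:-1, 1:] ^ k) i"
proof -
  have "(y_var - 1) ^ k = [:[:-1, 1:] ^ k:]"
    by (induction k) (auto simp: y_var_def one_pCons)
  then have "of_nat a * x_var ^ i * (y_var - 1) ^ k = [:of_nat a:] * monom 1 i * [:[:-1, 1:] ^ k:]"
    by (simp add: x_var_power of_nat_poly)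
  also have "\<dots> = monom (of_nat a * [:-1, 1:] ^ k) i"
    by (simp add: mult.commute[of _ "[:[:-1, 1:] ^ k:]"] smult_monom mult.commute)
  finally show ?thesis .
qed

lemma sum_monom_rev:
  "(\<Sum>j\<le>(i::nat). monom (g j :: int) (i - j)) = (\<Sum>k\<le>i. monom (g (i - k)) k)"
  by (rule sum.reindex_bij_witness[of _ "\<lambda>k. i - k" "\<lambda>k. i - k"]) auto

lemma coeff_sum_monom_rev:
  assumes "j \<le> (i::nat)"
  shows "coeff (\<Sum>j\<le>i. monom (g j :: int) (i - j)) (i - j) = g j"
  using assms by (simp add: sum_monom_rev coeff_sum)

lemma h_sum:
  "(\<Sum>i\<le>d. \<Sum>j\<le>i. of_int (h i j) * x_var ^ i * y_var ^ (i - j)) =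
   (\<Sum>i\<le>d. monom (\<Sum>j\<le>i. monom (h i j) (i - j)) i)"
  by (simp add: h_term monom_sum)

lemma h_triangle_exists: "\<exists>h. is_h_triangle \<Delta> h"
proof -
  define P :: "nat \<Rightarrow> int poly" where
    "P i = (\<Sum>j\<le>i. of_nat (f_triangle \<Delta> i j) * [:-1, 1:] ^ (i - j))" for i
  define h where "h i j = coeff (P i) (i - j)" for i j
  have "degree (P i) \<le> i" for i
    unfolding P_def
  proof (rule degree_sum_le)
    fix j
    have "degree ([:-1, 1:] ^ (i - j) :: int poly) \<le> i"
      using degree_power_le[of "[:-1, 1:] :: int poly" "i - j"] by simp
    then show "degree (of_nat (f_triangle \<Delta> i j) * [:-1, 1:] ^ (i - j) :: int poly) \<le> i"
      using degree_mult_le[of "of_nat (f_triangle \<Delta> i j)" "[:-1, 1:] ^ (i - j) :: int poly"]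
      by simp
  qed simp
  then have "(\<Sum>j\<le>i. monom (h i j) (i - j)) = P i" for i
    by (simp add: sum_monom_rev h_def poly_as_sum_of_monoms')
  then have "is_h_triangle \<Delta> h"
    by (simp add: is_h_triangle_def h_sum f_term P_def monom_sum)
  then show ?thesis by blast
qed

lemma h_triangle_unique:
  assumes "is_h_triangle \<Delta> h" "is_h_triangle \<Delta> h'" "j \<le> i" "i \<le> complex_rank \<Delta>"
  shows "h i j = h' i j"
proof -
  have "(\<Sum>i\<le>complex_rank \<Delta>. monom (\<Sum>j\<le>i. monom (h i j) (i - j)) i) =
        (\<Sum>i\<le>complex_rank \<Delta>. monom (\<Sum>j\<le>i. monom (h' i j) (i - j)) i)"
    using assms(1,2) by (simp add: is_h_triangle_def flip: h_sum)
  from arg_cong[OF this, of "\<lambda>p. coeff p i"]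
  have "(\<Sum>j\<le>i. monom (h i j) (i - j)) = (\<Sum>j\<le>i. monom (h' i j) (i - j))"
    using assms(4) by (simp add: coeff_sum)
  from arg_cong[OF this, of "\<lambda>p. coeff p (i - j)"] show ?thesis
    using assms(3) by (simp only: coeff_sum_monom_rev)
qed

end

theory Submission
  imports Defs
begin

text \<open>
  Recording a valley by the numbers of up- and down-steps preceding it identifies the faces of the
  complex with the chains of pairs \<open>(a, b)\<close>, \<open>1 \<le> b \<le> a < n\<close>, that increase strictly in both
  coordinates; a valley is successive iff its predecessor on the diagonal lies in the chain or is
  the origin. Every chain \<open>C\<close> extends canonically to a facet by running from the origin and from each
  of its points up the diagonal as far as the next point of \<open>C\<close> allows. This facet \<open>T\<close> has the largest
  size among the chains containing \<open>C\<close>, and it is the only facet for which all points of \<open>T - C\<close> are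
  successive. So the intervals from \<open>T\<close> without its successive points up to \<open>T\<close> partition the
  complex, respecting degrees; as a Boolean interval of rank \<open>s\<close> contributes
  \<open>(1 + (y - 1)) ^ s = y ^ s\<close>, the h-triangle counts facets by their successive points.
\<close>

section \<open>The h-triangle of a partitioned complex\<close>

lemma sum_card_fibres:
  fixes c :: "nat \<Rightarrow> 'b::semiring_1"
  assumes "finite A" and "\<And>a. a \<in> A \<Longrightarrow> g a \<le> i"
  shows "(\<Sum>j\<le>i. of_nat (card {a \<in> A. g a = j}) * c j) = (\<Sum>a\<in>A. c (g a))"
proof -
  have "(\<Sum>j\<le>i. of_nat (card {a \<in> A. g a = j}) * c j) = (\<Sum>j\<le>i. \<Sum>a | a \<in> A \<and> g a = j. c (g a))"
    by (intro sum.cong refl) simp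
  also have "\<dots> = (\<Sum>a\<in>A. c (g a))"
    using assms by (intro sum.group) auto
  finally show ?thesis .
qed

text \<open>The binomial theorem in subset form: when the product of \<open>z + 1\<close> over
  \<open>A\<close> is expanded, the factors contributing \<open>z\<close> form the subset.\<close>

lemma sum_Pow_power_card:
  fixes z :: "'b::comm_semiring_1"
  assumes "finite A"
  shows "(\<Sum>J\<in>Pow A. z ^ card J) = (z + 1) ^ card A"
  using prod_add[OF assms, of "\<lambda>_. z" "\<lambda>_. 1"] by simp

lemma face_degree_ge_card:
  assumes "finite \<Delta>" "\<sigma> \<in> \<Delta>"
  shows "card \<sigma> \<le> face_degree \<Delta> \<sigma>"
  unfolding face_degree_def using assms by (intro Max_ge) auto

text \<open>Fixing the power \<open>x_var ^ i\<close> leaves the intervals from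
  \<open>\<tau> - S \<tau>\<close> to \<open>\<tau>\<close> with \<open>card \<tau> = i\<close>.
  Each face in such an interval is \<open>\<tau> - J\<close> for one
  \<open>J \<subseteq> S \<tau>\<close>, and its weight depends only on \<open>card J\<close>, so
  the sum over an interval is a binomial expansion.\<close>

lemma is_h_triangle_of_partition:
  assumes fin: "finite \<Delta>" and finite_face: "\<And>\<sigma>. \<sigma> \<in> \<Delta> \<Longrightarrow> finite \<sigma>"
    and F: "F \<subseteq> \<Delta>"
    and S: "\<And>\<tau>. \<tau> \<in> F \<Longrightarrow> S \<tau> \<subseteq> \<tau>"
    and interval: "\<And>\<sigma> \<tau>. \<tau> \<in> F \<Longrightarrow> \<tau> - S \<tau> \<subseteq> \<sigma> \<Longrightarrow> \<sigma> \<subseteq> \<tau> \<Longrightarrow> \<sigma> \<in> \<Delta>"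
    and unique: "\<And>\<sigma>. \<sigma> \<in> \<Delta> \<Longrightarrow> \<exists>!\<tau>. \<tau> \<in> F \<and> \<tau> - S \<tau> \<subseteq> \<sigma> \<and> \<sigma> \<subseteq> \<tau>"
    and degree: "\<And>\<sigma> \<tau>. \<tau> \<in> F \<Longrightarrow> \<tau> - S \<tau> \<subseteq> \<sigma> \<Longrightarrow> \<sigma> \<subseteq> \<tau> \<Longrightarrow> face_degree \<Delta> \<sigma> = card \<tau>"
  shows "is_h_triangle \<Delta> (\<lambda>i j. int (card {\<tau> \<in> F. card \<tau> = i \<and> card (S \<tau>) = i - j}))"
proof -
  \<comment> \<open>\<open>t \<sigma>\<close> is the top of the only interval containing
    \<open>\<sigma>\<close>.\<close>
  define t where "t \<sigma> = (THE \<tau>. \<tau> \<in> F \<and> \<tau> - S \<tau> \<subseteq> \<sigma> \<and> \<sigma> \<subseteq> \<tau>)" for \<sigma>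
  have t: "t \<sigma> \<in> F" "t \<sigma> - S (t \<sigma>) \<subseteq> \<sigma>" "\<sigma> \<subseteq> t \<sigma>" if "\<sigma> \<in> \<Delta>" for \<sigma>
    using theI'[OF unique[OF that]] unfolding t_def by auto
  have t_eq: "t \<sigma> = \<tau>" if "\<tau> \<in> F" "\<tau> - S \<tau> \<subseteq> \<sigma>" "\<sigma> \<subseteq> \<tau>" for \<sigma> \<tau>
    unfolding t_def using unique[OF interval[OF that]] that by (intro the1_equality) auto
  have finF: "finite F"
    using F fin finite_subset by blast
  have "(\<Sum>j\<le>i. of_int (int (card {\<tau> \<in> F. card \<tau> = i \<and> card (S \<tau>) = i - j})) * x_var ^ i * y_var ^ (i - j))
      = (\<Sum>j\<le>i. of_nat (f_triangle \<Delta> i j) * x_var ^ i * (y_var - 1) ^ (i - j))" for i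
  proof -
    define Fi where "Fi = {\<tau> \<in> F. card \<tau> = i}"
    define \<Delta>i where "\<Delta>i = {\<sigma> \<in> \<Delta>. face_degree \<Delta> \<sigma> = i}"
    have S_le: "card (S \<tau>) \<le> i" if "\<tau> \<in> Fi" for \<tau>
      using that S[of \<tau>] F finite_face[of \<tau>] card_mono[of \<tau> "S \<tau>"] unfolding Fi_def by auto
    have "(\<Sum>j\<le>i. of_int (int (card {\<tau> \<in> F. card \<tau> = i \<and> card (S \<tau>) = i - j})) * x_var ^ i * y_var ^ (i - j))
        = (\<Sum>j\<le>i. of_nat (card {\<tau> \<in> Fi. i - card (S \<tau>) = j}) * (x_var ^ i * y_var ^ (i - j)))"
    proof (intro sum.cong refl)
      fix j assume "j \<in> {..i}"
      \<comment> \<open>The two truncated subtractions invert each other because both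
        \<open>j\<close> and \<open>card (S \<tau>)\<close> are at most \<open>i\<close>.\<close>
      then have "{\<tau> \<in> F. card \<tau> = i \<and> card (S \<tau>) = i - j} = {\<tau> \<in> Fi. i - card (S \<tau>) = j}"
        using S_le by (force simp: Fi_def)
      then show "of_int (int (card {\<tau> \<in> F. card \<tau> = i \<and> card (S \<tau>) = i - j})) * x_var ^ i * y_var ^ (i - j)
          = of_nat (card {\<tau> \<in> Fi. i - card (S \<tau>) = j}) * (x_var ^ i * y_var ^ (i - j))"
        by (simp add: mult.assoc)
    qed
    also have "\<dots> = (\<Sum>\<tau>\<in>Fi. x_var ^ i * y_var ^ (i - (i - card (S \<tau>))))"
      using finF by (intro sum_card_fibres) (auto simp: Fi_def)
    also have "\<dots> = (\<Sum>\<tau>\<in>Fi. \<Sum>\<sigma> | \<sigma> \<in> \<Delta>i \<and> t \<sigma> = \<tau>. x_var ^ i * (y_var - 1) ^ (i - card \<sigma>))"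
    proof (intro sum.cong refl)
      fix \<tau> assume \<tau>: "\<tau> \<in> Fi"
      then have \<tau>F: "\<tau> \<in> F" and card\<tau>: "card \<tau> = i" and fin\<tau>: "finite \<tau>"
        using F finite_face by (auto simp: Fi_def)
      have "y_var ^ (i - (i - card (S \<tau>))) = (y_var - 1 + 1) ^ card (S \<tau>)"
        using S_le[OF \<tau>] by simp
      also have "\<dots> = (\<Sum>J\<in>Pow (S \<tau>). (y_var - 1) ^ card J)"
        using finite_subset[OF S[OF \<tau>F] fin\<tau>] by (simp only: sum_Pow_power_card)
      also have "\<dots> = (\<Sum>\<sigma> | \<sigma> \<in> \<Delta>i \<and> t \<sigma> = \<tau>. (y_var - 1) ^ (i - card \<sigma>))"
      proof (rule sum.reindex_bij_witness[of _ "\<lambda>\<sigma>. \<tau> - \<sigma>" "\<lambda>J. \<tau> - J"])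
        fix J assume J: "J \<in> Pow (S \<tau>)"
        have "\<tau> - J \<in> \<Delta>" "face_degree \<Delta> (\<tau> - J) = i" "t (\<tau> - J) = \<tau>"
          using J card\<tau> by (auto intro!: interval[OF \<tau>F] degree[OF \<tau>F, THEN trans] t_eq[OF \<tau>F])
        then show "\<tau> - J \<in> {\<sigma> \<in> \<Delta>i. t \<sigma> = \<tau>}" by (simp add: \<Delta>i_def)
        show "\<tau> - (\<tau> - J) = J" using J S[OF \<tau>F] by auto
        have "finite J" "J \<subseteq> \<tau>" using J S[OF \<tau>F] fin\<tau> by (auto intro: finite_subset)
        then have "i - card (\<tau> - J) = card J"
          using card\<tau> card_mono[OF fin\<tau>, of J] by (simp add: card_Diff_subset)
        then show "(y_var - 1) ^ (i - card (\<tau> - J)) = (y_var - 1) ^ card J" by simp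
      next
        fix \<sigma> assume "\<sigma> \<in> {\<sigma> \<in> \<Delta>i. t \<sigma> = \<tau>}"
        then show "\<tau> - (\<tau> - \<sigma>) = \<sigma>" "\<tau> - \<sigma> \<in> Pow (S \<tau>)"
          using t[of \<sigma>] by (auto simp: \<Delta>i_def)
      qed
      finally show "x_var ^ i * y_var ^ (i - (i - card (S \<tau>)))
          = (\<Sum>\<sigma> | \<sigma> \<in> \<Delta>i \<and> t \<sigma> = \<tau>. x_var ^ i * (y_var - 1) ^ (i - card \<sigma>))"
        by (simp add: sum_distrib_left)
    qed
    \<comment> \<open>The fibres of \<open>t\<close> over \<open>Fi\<close> exhaust
      \<open>\<Delta>i\<close>: a face has degree \<open>i\<close> exactly when the top of its
      interval has \<open>i\<close> elements.\<close>
    also have "\<dots> = (\<Sum>\<sigma>\<in>\<Delta>i. x_var ^ i * (y_var - 1) ^ (i - card \<sigma>))"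
      using fin finF t degree[OF t] by (intro sum.group) (auto simp: Fi_def \<Delta>i_def)
    also have "\<dots> = (\<Sum>j\<le>i. of_nat (card {\<sigma> \<in> \<Delta>i. card \<sigma> = j}) * (x_var ^ i * (y_var - 1) ^ (i - j)))"
      using fin face_degree_ge_card[OF fin]
      by (intro sum_card_fibres[symmetric]) (auto simp: \<Delta>i_def)
    also have "\<dots> = (\<Sum>j\<le>i. of_nat (f_triangle \<Delta> i j) * x_var ^ i * (y_var - 1) ^ (i - j))"
      by (intro sum.cong refl) (simp add: f_triangle_def \<Delta>i_def mult.assoc conj_ac cong: conj_cong)
    finally show ?thesis .
  qed
  then show ?thesis
    unfolding is_h_triangle_def by simp
qed

section \<open>Invariance under injective relabelling of vertices\<close>

lemma face_degree_image:
  assumes "inj f"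
  shows "face_degree ((`) f ` \<Delta>) (f ` \<sigma>) = face_degree \<Delta> \<sigma>"
proof -
  have card_up: "{card \<tau> | \<tau>. \<tau> \<in> \<Gamma> \<and> \<rho> \<subseteq> \<tau>} = card ` {\<tau> \<in> \<Gamma>. \<rho> \<subseteq> \<tau>}"
    for \<Gamma> and \<rho> :: "'c set"
    by blast
  have "{\<tau> \<in> (`) f ` \<Delta>. f ` \<sigma> \<subseteq> \<tau>} = (`) f ` {\<tau> \<in> \<Delta>. \<sigma> \<subseteq> \<tau>}"
    by (auto simp: inj_image_subset_iff[OF assms])
  then have "card ` {\<tau> \<in> (`) f ` \<Delta>. f ` \<sigma> \<subseteq> \<tau>} = card ` {\<tau> \<in> \<Delta>. \<sigma> \<subseteq> \<tau>}"
    by (simp only: image_image card_image[OF inj_on_subset[OF assms subset_UNIV]])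
  then show ?thesis
    by (simp only: face_degree_def card_up)
qed

lemma f_triangle_image:
  assumes "inj f"
  shows "f_triangle ((`) f ` \<Delta>) i j = f_triangle \<Delta> i j"
proof -
  have "{\<sigma> \<in> (`) f ` \<Delta>. card \<sigma> = j \<and> face_degree ((`) f ` \<Delta>) \<sigma> = i}
      = (`) f ` {\<sigma> \<in> \<Delta>. card \<sigma> = j \<and> face_degree \<Delta> \<sigma> = i}"
    by (auto simp: face_degree_image[OF assms] card_image[OF inj_on_subset[OF assms subset_UNIV]])
  moreover have "inj_on ((`) f) X" for X
    by (rule inj_onI) (simp add: inj_image_eq_iff[OF assms])
  ultimately show ?thesis by (simp add: f_triangle_def card_image)
qed

lemma is_h_triangle_image:
  assumes "inj f"
  shows "is_h_triangle ((`) f ` \<Delta>) h \<longleftrightarrow> is_h_triangle \<Delta> h"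
proof -
  have "card ` (`) f ` \<Delta> = card ` \<Delta>"
    by (simp only: image_image card_image[OF inj_on_subset[OF assms subset_UNIV]])
  then show ?thesis
    by (simp only: is_h_triangle_def complex_rank_def f_triangle_image[OF assms])
qed

lemma maximal_face_image:
  assumes "inj f"
  shows "maximal_face ((`) f ` \<Delta>) (f ` \<sigma>) \<longleftrightarrow> maximal_face \<Delta> \<sigma>"
proof -
  have "inj ((`) f)"
    by (rule injI) (simp add: inj_image_eq_iff[OF assms])
  then show ?thesis
    by (simp add: maximal_face_def inj_image_mem_iff inj_image_subset_iff[OF assms]
        inj_image_eq_iff[OF assms])
qed

section \<open>Strict chains below the diagonal\<close>

definition strict_chains :: "nat \<Rightarrow> (nat \<times> nat) set set" where
  "strict_chains n = {C. (\<forall>(a, b)\<in>C. 1 \<le> b \<and> b \<le> a \<and> a < n) \<and>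
     (\<forall>(a, b)\<in>C. \<forall>(c, d)\<in>C. (a, b) = (c, d) \<or> a < c \<and> b < d \<or> c < a \<and> d < b)}"

text \<open>On a strict chain all coordinates are at least 1, so neither subtraction is
  truncated.\<close>

definition successive :: "(nat \<times> nat) set \<Rightarrow> (nat \<times> nat) set" where
  "successive C = {(a, b) \<in> C. (a - 1, b - 1) \<in> insert (0, 0) C}"

text \<open>Here \<open>k\<close> counts diagonal steps from a starting point \<open>(a, b)\<close>.
  \<open>k = 0\<close> keeps the points of \<open>C\<close>, \<open>0 < a + k\<close> drops the
  origin, and the last condition stops the run strictly before the next point of \<open>C\<close> in
  both coordinates.\<close>

definition fill :: "nat \<Rightarrow> (nat \<times> nat) set \<Rightarrow> (nat \<times> nat) set" where
  "fill n C = {(a + k, b + k) | a b k. (a, b) \<in> insert (0, 0) C \<and> 0 < a + k \<and> a + k < n \<and>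
     (\<forall>(c, d)\<in>C. a < c \<longrightarrow> a + k < c \<and> b + k < d)}"

lemma strict_chains_bounds:
  assumes "C \<in> strict_chains n" "(a, b) \<in> C"
  shows "1 \<le> b" "b \<le> a" "a < n"
  using assms by (auto simp: strict_chains_def)

lemma strict_chains_cases:
  assumes "C \<in> strict_chains n" "(a, b) \<in> C" "(c, d) \<in> C"
  shows "a = c \<and> b = d \<or> a < c \<and> b < d \<or> c < a \<and> d < b"
  using assms by (fastforce simp: strict_chains_def)

text \<open>Positive coordinates place every point of \<open>C\<close> strictly above the origin,
  which can thus act as one more starting point.\<close>

lemma strict_chains_insert_cases:
  assumes "C \<in> strict_chains n" "(a, b) \<in> insert (0, 0) C" "(c, d) \<in> insert (0, 0) C"
  shows "a = c \<and> b = d \<or> a < c \<and> b < d \<or> c < a \<and> d < b"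
  using strict_chains_cases[OF assms(1), of a b c d] strict_chains_bounds[OF assms(1), of a b]
    strict_chains_bounds[OF assms(1), of c d] assms(2,3) by auto

lemma strict_chains_subset: "C \<in> strict_chains n \<Longrightarrow> B \<subseteq> C \<Longrightarrow> B \<in> strict_chains n"
  unfolding strict_chains_def by blast

lemma strict_chain_subset_square: "C \<in> strict_chains n \<Longrightarrow> C \<subseteq> {..<n} \<times> {..<n}"
  using strict_chains_bounds by fastforce

lemma finite_strict_chains: "finite (strict_chains n)"
  by (rule finite_subset[of _ "Pow ({..<n} \<times> {..<n})"]) (auto dest: strict_chain_subset_square)

lemma finite_strict_chain: "C \<in> strict_chains n \<Longrightarrow> finite C"
  by (rule finite_subset[OF strict_chain_subset_square]) auto

section \<open>Fillings of strict chains\<close>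

lemma fillI:
  assumes "(a, b) \<in> insert (0, 0) C" "0 < a + k" "a + k < n"
    and "\<And>c d. (c, d) \<in> C \<Longrightarrow> a < c \<Longrightarrow> a + k < c \<and> b + k < d"
  shows "(a + k, b + k) \<in> fill n C"
  using assms unfolding fill_def by blast

lemma fillE:
  assumes "p \<in> fill n C"
  obtains a b k where "p = (a + k, b + k)" "(a, b) \<in> insert (0, 0) C" "0 < a + k" "a + k < n"
    "\<And>c d. (c, d) \<in> C \<Longrightarrow> a < c \<Longrightarrow> a + k < c \<and> b + k < d"
  using assms unfolding fill_def by blast

lemma fill_superset:
  assumes C: "C \<in> strict_chains n"
  shows "C \<subseteq> fill n C"
proof
  fix p assume p: "p \<in> C"
  obtain a b where [simp]: "p = (a, b)" by (cases p)
  have "b < d" if "(c, d) \<in> C" "a < c" for c d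
    using strict_chains_cases[OF C, of a b c d] p that by simp
  then show "p \<in> fill n C"
    using p strict_chains_bounds[OF C, of a b] fillI[of a b C 0 n] by simp
qed

text \<open>Two points on the same run differ by a diagonal step. On different runs, the run that
  starts lower ends strictly before the start of the other.\<close>

lemma fill_in_strict_chains:
  assumes C: "C \<in> strict_chains n"
  shows "fill n C \<in> strict_chains n"
proof -
  have "1 \<le> b \<and> b \<le> a \<and> a < n" if ab: "(a, b) \<in> fill n C" for a b
  proof -
    obtain a0 b0 k where "(a, b) = (a0 + k, b0 + k)" "(a0, b0) \<in> insert (0, 0) C" "0 < a0 + k"
      "a0 + k < n" "\<And>c d. (c, d) \<in> C \<Longrightarrow> a0 < c \<Longrightarrow> a0 + k < c \<and> b0 + k < d"
      using ab by (rule fillE) (use that in blast)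
    then show ?thesis using strict_chains_bounds[OF C, of a0 b0] by auto
  qed
  moreover have "(a, b) = (c, d) \<or> a < c \<and> b < d \<or> c < a \<and> d < b"
    if ab: "(a, b) \<in> fill n C" and cd: "(c, d) \<in> fill n C" for a b c d
  proof -
    obtain a0 b0 k where 1: "(a, b) = (a0 + k, b0 + k)" "(a0, b0) \<in> insert (0, 0) C" "0 < a0 + k"
      "a0 + k < n" "\<And>c d. (c, d) \<in> C \<Longrightarrow> a0 < c \<Longrightarrow> a0 + k < c \<and> b0 + k < d"
      using ab by (rule fillE) (use that in blast)
    obtain c0 d0 l where 2: "(c, d) = (c0 + l, d0 + l)" "(c0, d0) \<in> insert (0, 0) C" "0 < c0 + l"
      "c0 + l < n" "\<And>a b. (a, b) \<in> C \<Longrightarrow> c0 < a \<Longrightarrow> c0 + l < a \<and> d0 + l < b"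
      using cd by (rule fillE) (use that in blast)
    consider "a0 = c0" "b0 = d0" | "a0 < c0" "(c0, d0) \<in> C" | "c0 < a0" "(a0, b0) \<in> C"
      using strict_chains_insert_cases[OF C 1(2) 2(2)] 1(2) 2(2) by auto
    then show ?thesis
    proof cases
      case 1
      then show ?thesis using \<open>(a, b) = _\<close> \<open>(c, d) = _\<close> by auto
    next
      case 2
      then show ?thesis using 1(5)[of c0 d0] \<open>(a, b) = _\<close> \<open>(c, d) = _\<close> by auto
    next
      case 3
      then show ?thesis using 2(5)[of a0 b0] \<open>(a, b) = _\<close> \<open>(c, d) = _\<close> by auto
    qed
  qed
  ultimately show ?thesis unfolding strict_chains_def by blast
qed

text \<open>Relates \<open>p\<close> to the point as far up the diagonal as \<open>p\<close> permits, starting from the last point of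
  \<open>C\<close> (or the origin) below \<open>p\<close>. This injects any chain containing \<open>C\<close> into the filling of \<open>C\<close>.\<close>

definition slides_to :: "(nat \<times> nat) set \<Rightarrow> nat \<times> nat \<Rightarrow> nat \<times> nat \<Rightarrow> bool" where
  "slides_to C p z \<longleftrightarrow> (\<exists>a b. (a, b) \<in> insert (0, 0) C \<and> a \<le> fst p \<and>
     (\<forall>c d. (c, d) \<in> C \<longrightarrow> a < c \<longrightarrow> fst p < c) \<and>
     z = (a + min (fst p - a) (snd p - b), b + min (fst p - a) (snd p - b)))"

lemma slides_to_fill:
  assumes E: "E \<in> strict_chains n" and "C \<subseteq> E" and p: "p \<in> E"
  shows "\<exists>z\<in>fill n C. slides_to C p z"
proof -
  obtain x y where [simp]: "p = (x, y)" by (cases p)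
  have C: "C \<in> strict_chains n" using strict_chains_subset assms by blast
  \<comment> \<open>The rightmost element of \<open>Q\<close> is the last starting point not to the
    right of \<open>p\<close>.\<close>
  define Q where "Q = {q \<in> insert (0, 0) C. fst q \<le> x}"
  have "finite Q" "Q \<noteq> {}"
    using finite_strict_chain[OF C] by (auto simp: Q_def)
  then have M: "Max (fst ` Q) \<in> fst ` Q" "\<And>q. q \<in> Q \<Longrightarrow> fst q \<le> Max (fst ` Q)"
    by auto
  then obtain a b where ab: "(a, b) \<in> Q" and max: "\<And>c d. (c, d) \<in> Q \<Longrightarrow> c \<le> a"
    by (metis fst_conv imageE prod.collapse)
  have above: "x < c" if "(c, d) \<in> C" "a < c" for c d
    using max[of c d] that by (force simp: Q_def)
  have abE: "(a, b) \<in> insert (0, 0) E" "(a, b) \<in> insert (0, 0) C" "a \<le> x"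
    using ab \<open>C \<subseteq> E\<close> by (auto simp: Q_def)
  have xy: "1 \<le> y" "y \<le> x" "x < n" using strict_chains_bounds[OF E] p by auto
  have "b \<le> y"
    \<comment> \<open>Both points lie in \<open>E\<close> together with the origin, so
      \<open>a \<le> x\<close> forces \<open>b \<le> y\<close>.\<close>
    using strict_chains_insert_cases[OF E abE(1), of x y] p abE by auto
  define k where "k = min (x - a) (y - b)"
  have k: "a + k \<le> x" "b + k \<le> y" using abE(3) \<open>b \<le> y\<close> by (auto simp: k_def)
  have "0 < a + k"
    using xy strict_chains_bounds[OF C, of a b] abE(2) by (auto simp: k_def)
  \<comment> \<open>A later point of \<open>C\<close> exceeds \<open>p\<close> in both coordinates,
    by comparability in \<open>E\<close>, while the slid point does not exceed \<open>p\<close> in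
    either.\<close>
  moreover have "a + k < c \<and> b + k < d" if "(c, d) \<in> C" "a < c" for c d
    using above[OF that] strict_chains_cases[OF E, of x y c d] p \<open>C \<subseteq> E\<close> that(1) k by auto
  ultimately have "(a + k, b + k) \<in> fill n C"
    using k xy by (intro fillI abE(2)) auto
  moreover have "slides_to C p (a + k, b + k)"
    unfolding slides_to_def k_def using abE above by (intro exI[of _ a] exI[of _ b]) simp
  ultimately show ?thesis by blast
qed

text \<open>The starting points agree: if \<open>a < c\<close>, then \<open>x < c\<close>, although
  \<open>z\<close> lies weakly right of \<open>c\<close> and weakly left of \<open>x\<close>. From a
  common start, the larger of two distinct points of \<open>E\<close> exceeds the other in both
  coordinates, hence slides strictly further.\<close>

lemma slides_to_inj:
  assumes E: "E \<in> strict_chains n" and "C \<subseteq> E"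
    and "p \<in> E" "q \<in> E" "slides_to C p z" "slides_to C q z"
  shows "p = q"
proof -
  obtain x y x' y' where [simp]: "p = (x, y)" "q = (x', y')" by (cases p; cases q)
  obtain a b where 1: "(a, b) \<in> insert (0, 0) C" "a \<le> x" "\<forall>c d. (c, d) \<in> C \<longrightarrow> a < c \<longrightarrow> x < c"
    "z = (a + min (x - a) (y - b), b + min (x - a) (y - b))"
    using assms(5) unfolding slides_to_def \<open>p = _\<close> \<open>q = _\<close> fst_conv snd_conv
    by (elim exE conjE) (rule that)
  obtain c d where 2: "(c, d) \<in> insert (0, 0) C" "c \<le> x'" "\<forall>a b. (a, b) \<in> C \<longrightarrow> c < a \<longrightarrow> x' < a"
    "z = (c + min (x' - c) (y' - d), d + min (x' - c) (y' - d))"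
    using assms(6) unfolding slides_to_def \<open>p = _\<close> \<open>q = _\<close> fst_conv snd_conv
    by (elim exE conjE) (rule that)
  have C: "C \<in> strict_chains n" using strict_chains_subset assms(1,2) by blast
  have z: "a \<le> fst z" "fst z \<le> x" using 1(2,4) by simp_all
  have z': "c \<le> fst z" "fst z \<le> x'" using 2(2,4) by simp_all
  have "\<not> a < c"
  proof
    assume "a < c"
    then have "x < c" using 1(3) 2(1) by blast
    then show False using z z' by linarith
  qed
  moreover have "\<not> c < a"
  proof
    assume "c < a"
    then have "x' < a" using 1(1) 2(3) by blast
    then show False using z z' by linarith
  qed
  ultimately have [simp]: "a = c" "b = d"
    using strict_chains_insert_cases[OF C 1(1) 2(1)] by auto
  \<comment> \<open>This keeps \<open>y - b\<close> and \<open>y' - b\<close> from being truncated,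
    so that the minima are strictly monotone.\<close>
  have "b \<le> y" "b \<le> y'"
    using strict_chains_insert_cases[OF E, of a b x y] strict_chains_insert_cases[OF E, of a b x' y']
      1(1,2) 2(1,2) assms(3,4) subsetD[OF \<open>C \<subseteq> E\<close>, of "(a, b)"] by auto
  then show ?thesis
    using 1(2,4) 2(2,4) strict_chains_cases[OF E, of x y x' y'] assms(3,4) by auto
qed

lemma card_le_card_fill:
  assumes "E \<in> strict_chains n" "C \<subseteq> E"
  shows "card E \<le> card (fill n C)"
proof (rule card_le_if_inj_on_rel[where r = "slides_to C"])
  show "finite (fill n C)"
    using assms fill_in_strict_chains finite_strict_chain strict_chains_subset by blast
  show "\<exists>z. z \<in> fill n C \<and> slides_to C p z" if "p \<in> E" for p
    using slides_to_fill[OF assms that] by blast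
  show "p = q" if "p \<in> E" "q \<in> E" "slides_to C p z" "slides_to C q z" for p q z
    using slides_to_inj[OF assms that] .
qed

text \<open>A chain containing the filling also contains \<open>C\<close>, so it has no more points
  than the filling and equals it.\<close>

lemma maximal_face_fill:
  assumes "C \<in> strict_chains n"
  shows "maximal_face (strict_chains n) (fill n C)"
  unfolding maximal_face_def
  using assms fill_in_strict_chains fill_superset card_le_card_fill finite_strict_chain card_seteq
  by (metis subset_trans)

lemma face_degree_strict_chains:
  assumes C: "C \<in> strict_chains n"
  shows "face_degree (strict_chains n) C = card (fill n C)"
  unfolding face_degree_def
  using C finite_strict_chains fill_in_strict_chains[OF C] fill_superset[OF C] card_le_card_fill
  by (intro Max_eqI) auto

text \<open>A point reached after \<open>Suc l\<close> diagonal steps has the point after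
  \<open>l\<close> steps as predecessor, which is in the filling or is the origin. Only points with
  \<open>k = 0\<close> can fail to be successive, and these belong to \<open>C\<close>.\<close>

lemma fill_minus_successive_subset:
  assumes C: "C \<in> strict_chains n"
  shows "fill n C - successive (fill n C) \<subseteq> C"
proof
  fix p assume p: "p \<in> fill n C - successive (fill n C)"
  then obtain a b k where k: "p = (a + k, b + k)" "(a, b) \<in> insert (0, 0) C" "0 < a + k" "a + k < n"
    "\<And>c d. (c, d) \<in> C \<Longrightarrow> a < c \<Longrightarrow> a + k < c \<and> b + k < d"
    by (auto elim!: fillE)
  show "p \<in> C"
  proof (cases k)
    case 0
    then show ?thesis using k by auto
  next
    case (Suc l)
    have "(a + l, b + l) \<in> insert (0, 0) (fill n C)"
    proof (cases "a + l = 0")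
      case True
      then show ?thesis using k(2) strict_chains_bounds[OF C, of a b] by auto
    next
      case False
      then have "(a + l, b + l) \<in> fill n C"
        using k Suc by (intro fillI) fastforce+
      then show ?thesis by simp
    qed
    then have "p \<in> successive (fill n C)"
      using p k(1) Suc by (simp add: successive_def)
    then show ?thesis using p by simp
  qed
qed

text \<open>By maximality of \<open>T\<close> one inclusion suffices. It follows by induction on the
  first coordinate: a point of \<open>T\<close> outside \<open>C\<close> is successive, so it
  continues the run through its predecessor by one step.\<close>

lemma eq_fill_of_interval:
  assumes T: "maximal_face (strict_chains n) T" and "T - successive T \<subseteq> C" and "C \<subseteq> T"
  shows "T = fill n C"
proof -
  have TK: "T \<in> strict_chains n" using T by (simp add: maximal_face_def)
  then have C: "C \<in> strict_chains n" using strict_chains_subset \<open>C \<subseteq> T\<close> by blast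
  have "(x, y) \<in> T \<Longrightarrow> (x, y) \<in> fill n C" for x y
  proof (induction x arbitrary: y)
    case 0
    then show ?case using strict_chains_bounds[OF TK] by fastforce
  next
    case (Suc x y)
    note bounds = strict_chains_bounds[OF TK Suc.prems]
    show ?case
    proof (cases "(Suc x, y) \<in> C")
      case True
      then show ?thesis using fill_superset[OF C] by blast
    next
      case False
      then have "(Suc x, y) \<in> successive T" using Suc.prems assms(2) by blast
      then have pred: "(x, y - 1) \<in> insert (0, 0) T" by (simp add: successive_def)
      \<comment> \<open>Either the predecessor already lies on a run, or it is the origin and starts
        one with \<open>a = b = k = 0\<close>.\<close>
      obtain a b k where k: "x = a + k" "y - 1 = b + k" "(a, b) \<in> insert (0, 0) C"
        "\<And>c d. (c, d) \<in> C \<Longrightarrow> a < c \<Longrightarrow> a + k < c \<and> b + k < d"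
      proof (cases "(x, y - 1) \<in> T")
        case True
        from Suc.IH[OF this] show ?thesis by (elim fillE) (auto intro: that)
      next
        case False
        then have "x = 0" "y - 1 = 0" using pred by auto
        then show ?thesis
          using strict_chains_bounds[OF C] by (intro that[of 0 0 0]) fastforce+
      qed
      \<comment> \<open>The next point of \<open>C\<close> is comparable in \<open>T\<close> with
        \<open>(Suc x, y)\<close> and differs from it, as \<open>(Suc x, y)\<close> is not in
        \<open>C\<close>; so the longer run still stops before it.\<close>
      have "a + Suc k < c \<and> b + Suc k < d" if "(c, d) \<in> C" "a < c" for c d
        using strict_chains_cases[OF TK Suc.prems subsetD[OF \<open>C \<subseteq> T\<close> that(1)]]
          k(1,2) k(4)[OF that] that False bounds by auto
      then have "(a + Suc k, b + Suc k) \<in> fill n C"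
        using k(1,3) bounds by (intro fillI) auto
      moreover have "y = b + Suc k" using k(2) bounds by simp
      ultimately show ?thesis using k(1) by simp
    qed
  qed
  then have "T \<subseteq> fill n C" by auto
  then show ?thesis
    using T fill_in_strict_chains[OF C] by (auto simp: maximal_face_def)
qed

lemma is_h_triangle_strict_chains:
  "is_h_triangle (strict_chains n)
     (\<lambda>i j. int (card {T. maximal_face (strict_chains n) T \<and> card T = i \<and> card (successive T) = i - j}))"
proof -
  let ?F = "{T. maximal_face (strict_chains n) T}"
  have FK: "?F \<subseteq> strict_chains n" by (auto simp: maximal_face_def)
  have "is_h_triangle (strict_chains n)
     (\<lambda>i j. int (card {T \<in> ?F. card T = i \<and> card (successive T) = i - j}))"
  proof (rule is_h_triangle_of_partition[OF finite_strict_chains finite_strict_chain FK])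
    fix C assume C: "C \<in> strict_chains n"
    show "\<exists>!T. T \<in> ?F \<and> T - successive T \<subseteq> C \<and> C \<subseteq> T"
    proof (intro ex1I[of _ "fill n C"])
      show "fill n C \<in> ?F \<and> fill n C - successive (fill n C) \<subseteq> C \<and> C \<subseteq> fill n C"
        using C maximal_face_fill fill_minus_successive_subset fill_superset by simp
    qed (use eq_fill_of_interval in auto)
  next
    fix C T assume T: "T \<in> ?F" "T - successive T \<subseteq> C" "C \<subseteq> T"
    then show "C \<in> strict_chains n" using FK strict_chains_subset by blast
    then show "face_degree (strict_chains n) C = card T"
      using T eq_fill_of_interval face_degree_strict_chains by auto
  qed (auto simp: successive_def)
  then show ?thesis by simp
qed

text \<open>Witnessed by the diagonal. The bound places all indices up to \<open>n - 1\<close> in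
  the range where the h-triangle is uniquely determined.\<close>

lemma complex_rank_strict_chains: "n - 1 \<le> complex_rank (strict_chains n)"
proof -
  let ?C = "(\<lambda>k. (k, k)) ` {1..<n}"
  have "?C \<in> strict_chains n" by (auto simp: strict_chains_def)
  then have "card ?C \<le> complex_rank (strict_chains n)"
    unfolding complex_rank_def using finite_strict_chains by (intro Max_ge) auto
  then show ?thesis by (simp add: card_image inj_on_def)
qed

section \<open>Valleys of Dyck paths as strict chains\<close>

definition valley_counts :: "step list \<Rightarrow> (nat \<times> nat) set" where
  "valley_counts w = {(count_list (take i w) U, count_list (take i w) D) | i.
     1 \<le> i \<and> i < length w \<and> w ! (i - 1) = D \<and> w ! i = U}"

text \<open>A diagonal step by \<open>(1, 1)\<close> becomes a shift by \<open>(2, 0)\<close>, the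
  one in the definition of successive valleys.\<close>

definition position :: "nat \<times> nat \<Rightarrow> int \<times> int" where
  "position = (\<lambda>(a, b). (int a + int b, int a - int b))"

lemma inj_position: "inj position"
  by (auto simp: inj_def position_def)

lemma count_U_plus_count_D: "count_list w U + count_list w D = length w"
proof (induction w)
  case (Cons c w)
  then show ?case by (cases c) auto
qed simp

lemma valleys_eq_position: "valleys w = position ` valley_counts w"
proof -
  have "position (count_list (take i w) U, count_list (take i w) D) = (int i, height (take i w))"
    if "i < length w" for i
    using that count_U_plus_count_D[of "take i w"] by (simp add: position_def height_def)
  then show ?thesis
    unfolding valleys_def valley_counts_def setcompr_eq_image image_image by (intro image_cong) auto
qed

section \<open>Letter counts along prefixes\<close>

lemma count_list_take_mono: "i \<le> j \<Longrightarrow> count_list (take i w) c \<le> count_list (take j w) c"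
  by (metis count_list_append le_add1 le_add_diff_inverse take_add)

lemma count_list_take_Suc:
  "i < length w \<Longrightarrow> count_list (take (Suc i) w) c = count_list (take i w) c + (if w ! i = c then 1 else 0)"
  by (simp add: take_Suc_conv_app_nth)

lemma count_list_take_less:
  assumes "i < j" "i < length w" "w ! i = c"
  shows "count_list (take i w) c < count_list (take j w) c"
  using count_list_take_mono[of "Suc i" j w c] count_list_take_Suc[of i w c] assms by simp

text \<open>The up-step leaving the earlier valley and the down-step entering the later one both lie
  between the two positions.\<close>

lemma valley_counts_less:
  assumes "i < j" "i < length w" "j < length w" "w ! i = U" "w ! (j - 1) = D"
  shows "count_list (take i w) U < count_list (take j w) U" "count_list (take i w) D < count_list (take j w) D"
proof -
  show "count_list (take i w) U < count_list (take j w) U"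
    using assms by (intro count_list_take_less)
  have "count_list (take i w) D \<le> count_list (take (j - 1) w) D"
    using assms by (intro count_list_take_mono) simp
  also have "\<dots> < count_list (take j w) D"
    using assms by (intro count_list_take_less) simp_all
  finally show "count_list (take i w) D < count_list (take j w) D" .
qed

text \<open>The down-step before a valley gives \<open>1 \<le> b\<close>, the up-step after it gives
  \<open>a < n\<close>, and the prefix condition gives \<open>b \<le> a\<close>.\<close>

lemma valley_counts_in_strict_chains:
  assumes w: "w \<in> Dyck n"
  shows "valley_counts w \<in> strict_chains n"
proof -
  have cnt: "count_list w U = n"
    using w count_U_plus_count_D[of w] by (simp add: Dyck_def)
  have "1 \<le> b \<and> b \<le> a \<and> a < n" if ab: "(a, b) \<in> valley_counts w" for a b
  proof -
    obtain i where i: "a = count_list (take i w) U" "b = count_list (take i w) D"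
      "1 \<le> i" "i < length w" "w ! (i - 1) = D" "w ! i = U"
      using ab unfolding valley_counts_def by blast
    then have "count_list (take (i - 1) w) D < count_list (take i w) D"
      by (intro count_list_take_less) simp_all
    then show ?thesis
      using i w cnt count_list_take_less[of i "length w" w U]
      by (auto simp: Dyck_def)
  qed
  moreover have "(a, b) = (c, d) \<or> a < c \<and> b < d \<or> c < a \<and> d < b"
    if ab: "(a, b) \<in> valley_counts w" and cd: "(c, d) \<in> valley_counts w" for a b c d
  proof -
    obtain i where i: "a = count_list (take i w) U" "b = count_list (take i w) D"
      "i < length w" "w ! (i - 1) = D" "w ! i = U"
      using ab unfolding valley_counts_def by blast
    obtain j where j: "c = count_list (take j w) U" "d = count_list (take j w) D"
      "j < length w" "w ! (j - 1) = D" "w ! j = U"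
      using cd unfolding valley_counts_def by blast
    show ?thesis
      using i j valley_counts_less[of i j w] valley_counts_less[of j i w]
      by (cases i j rule: linorder_cases) auto
  qed
  ultimately show ?thesis unfolding strict_chains_def by blast
qed

text \<open>The valleys dictate the path greedily: after a prefix with \<open>a\<close> up-steps and \<open>b\<close> down-steps, it
  must descend exactly when all up-steps are spent or a valley lies straight ahead.\<close>

lemma nth_eq_D_iff:
  assumes i: "i < length w"
  shows "w ! i = D \<longleftrightarrow> count_list (take i w) U = count_list w U \<or>
    (\<exists>b > count_list (take i w) D. (count_list (take i w) U, b) \<in> valley_counts w)"
proof
  assume D: "w ! i = D"
  show "count_list (take i w) U = count_list w U \<or>
    (\<exists>b > count_list (take i w) D. (count_list (take i w) U, b) \<in> valley_counts w)"
  proof (cases "\<exists>j. i < j \<and> j < length w \<and> w ! j = U")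
    case True
    \<comment> \<open>Up to the first later up-step, at \<open>j\<close>, the path only descends, so
      \<open>j\<close> is a valley with the same number of up-steps.\<close>
    from iffD1[OF exists_least_iff True] obtain j where j: "i < j" "j < length w" "w ! j = U"
      and least: "\<And>k. k < j \<Longrightarrow> \<not> (i < k \<and> k < length w \<and> w ! k = U)"
      by blast
    have run: "w ! k = D" if "i \<le> k" "k < j" for k
      using least[of k] that D j(2) by (cases "w ! k"; cases "k = i") auto
    have no_U: "count_list (take k w) U = count_list (take i w) U" if "i \<le> k" "k \<le> j" for k
      using that
    proof (induction k rule: dec_induct)
      case (step k)
      then show ?case using run[of k] j(2) by (simp add: count_list_take_Suc)
    qed simp
    have "count_list (take j w) U = count_list (take i w) U"
      using no_U[of j] j(1) by simp
    moreover have "count_list (take i w) D < count_list (take j w) D"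
      using count_list_take_less[of i j w D] D i j(1) by simp
    moreover have "(count_list (take j w) U, count_list (take j w) D) \<in> valley_counts w"
      using j run[of "j - 1"] unfolding valley_counts_def by (intro CollectI exI[of _ j]) auto
    ultimately show ?thesis by auto
  next
    case False
    have no_U: "count_list (take k w) U = count_list (take i w) U" if "i \<le> k" "k \<le> length w" for k
      using that
    proof (induction k rule: dec_induct)
      case (step k)
      then have "w ! k \<noteq> U" using False D by (cases "k = i") auto
      then show ?case using step by (simp add: count_list_take_Suc)
    qed simp
    show ?thesis using no_U[of "length w"] i by simp
  qed
next
  assume r: "count_list (take i w) U = count_list w U \<or>
    (\<exists>b > count_list (take i w) D. (count_list (take i w) U, b) \<in> valley_counts w)"
  show "w ! i = D"
  proof (rule ccontr)
    assume "w ! i \<noteq> D"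
    then have u: "w ! i = U" by (cases "w ! i") auto
    then have "count_list (take i w) U < count_list w U"
      using count_list_take_less[of i "length w" w U] i by simp
    then obtain j where j: "count_list (take i w) D < count_list (take j w) D"
      "count_list (take i w) U = count_list (take j w) U"
      using r by (auto simp: valley_counts_def)
    \<comment> \<open>A prefix with more down-steps is longer, so it contains the up-step at
      \<open>i\<close>, against the equal numbers of up-steps.\<close>
    have "i < j"
      using j(1) count_list_take_mono[of j i w D] by (meson leD not_le)
    then show False using count_list_take_less[of i j w U] u i j(2) by simp
  qed
qed

text \<open>The greedy rule computes each letter from the preceding prefix and the valley set, so
  two paths with equal valleys agree prefix by prefix.\<close>

lemma inj_on_valley_counts: "inj_on valley_counts (Dyck n)"
proof
  fix w v assume w: "w \<in> Dyck n" and v: "v \<in> Dyck n" and eq: "valley_counts w = valley_counts v"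
  have len: "length w = length v" and cnt: "count_list w U = count_list v U"
    using w v count_U_plus_count_D[of w] count_U_plus_count_D[of v] by (auto simp: Dyck_def)
  have "i \<le> length w \<Longrightarrow> take i w = take i v" for i
  proof (induction i)
    case (Suc i)
    then have "w ! i = D \<longleftrightarrow> v ! i = D"
      using nth_eq_D_iff[of i w] nth_eq_D_iff[of i v] len cnt eq by simp
    then have "w ! i = v ! i" by (metis step.exhaust)
    then show ?case using Suc len by (simp add: take_Suc_conv_app_nth)
  qed simp
  from this[of "length w"] show "w = v" using len by simp
qed

section \<open>Paths with prescribed valleys\<close>

definition ballot :: "step list \<Rightarrow> bool" where
  "ballot w \<longleftrightarrow> (\<forall>k\<le>length w. count_list (take k w) D \<le> count_list (take k w) U)"

lemma ballot_snoc:
  "ballot (w @ [c]) \<longleftrightarrow> ballot w \<and> count_list (w @ [c]) D \<le> count_list (w @ [c]) U"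
  unfolding ballot_def by (auto simp: le_Suc_eq)

lemma ballot_append_U: "ballot w \<Longrightarrow> ballot (w @ replicate k U)"
proof (induction k)
  case (Suc k)
  then have "count_list (w @ replicate k U) D \<le> count_list (w @ replicate k U) U"
    unfolding ballot_def by (metis le_refl take_all)
  then show ?case
    using Suc ballot_snoc[of "w @ replicate k U" U] by (simp add: replicate_append_same)
qed simp

lemma ballot_append_D:
  "ballot w \<Longrightarrow> count_list w D + k \<le> count_list w U \<Longrightarrow> ballot (w @ replicate k D)"
proof (induction k)
  case (Suc k)
  have "count_list (replicate k D) D = k" "count_list (replicate k D) U = 0"
    by (induction k) auto
  then show ?case
    using Suc ballot_snoc[of "w @ replicate k D" D] by (simp add: replicate_append_same)
qed simp

lemma valley_counts_snoc:
  "valley_counts (w @ [c]) = valley_counts w \<union>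
     (if c = U \<and> w \<noteq> [] \<and> last w = D then {(count_list w U, count_list w D)} else {})"
proof (cases "w = []")
  case True
  then show ?thesis by (auto simp: valley_counts_def)
next
  case False
  define I where "I v = {i. 1 \<le> i \<and> i < length v \<and> v ! (i - 1) = D \<and> v ! i = U}" for v
  have V: "valley_counts v = (\<lambda>i. (count_list (take i v) U, count_list (take i v) D)) ` I v" for v
    unfolding valley_counts_def I_def by blast
  have "last w = w ! (length w - 1)" using False by (simp add: last_conv_nth)
  then have I: "I (w @ [c]) = I w \<union> (if c = U \<and> last w = D then {length w} else {})"
    using False by (auto simp: I_def nth_append less_Suc_eq Suc_le_eq)
  \<comment> \<open>Indices in \<open>I (w @ [c])\<close> are at most \<open>length w\<close>, so
    the prefixes there ignore the appended letter.\<close>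
  have "valley_counts (w @ [c]) = (\<lambda>i. (count_list (take i w) U, count_list (take i w) D)) ` I (w @ [c])"
    unfolding V by (rule image_cong) (simp_all add: I_def)
  then show ?thesis
    using False by (simp add: I V)
qed

lemma valley_counts_append_D: "valley_counts (w @ replicate k D) = valley_counts w"
proof (induction k)
  case (Suc k)
  then show ?case
    using valley_counts_snoc[of "w @ replicate k D" D] by (simp add: replicate_append_same)
qed simp

lemma valley_counts_append_U:
  assumes "w \<noteq> []" "last w = D" "0 < k"
  shows "valley_counts (w @ replicate k U) = insert (count_list w U, count_list w D) (valley_counts w)"
  using \<open>0 < k\<close>
proof (induction k rule: nat_induct_non_zero)
  case 1
  then show ?case using assms valley_counts_snoc[of w U] by simp
next
  case (Suc k)
  then have "last (w @ replicate k U) = U" by simp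
  then show ?case
    using Suc valley_counts_snoc[of "w @ replicate k U" U] by (simp add: replicate_append_same)
qed

lemma valley_counts_replicate_U: "valley_counts (replicate k U) = {}"
  by (auto simp: valley_counts_def)

text \<open>The endpoint \<open>(N, M)\<close> is arbitrary so that the induction can build the path
  up to the top point of \<open>C\<close> first. Ending in \<open>D\<close> makes a following
  up-step create a valley there.\<close>

lemma ex_ballot_with_valley_counts:
  assumes "C \<in> strict_chains n" "\<And>a b. (a, b) \<in> C \<Longrightarrow> a < N \<and> b < M" "1 \<le> M" "M \<le> N"
  shows "\<exists>w. ballot w \<and> w \<noteq> [] \<and> last w = D \<and> count_list w U = N \<and> count_list w D = M \<and> valley_counts w = C"
  using assms
proof (induction N arbitrary: C M rule: less_induct)
  case (less N)
  have cnt: "count_list (replicate k c) c' = (if c = c' then k else 0)" for k and c c' :: step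
    by (induction k) auto
  show ?case
  proof (cases "C = {}")
    case True
    have "ballot []" by (simp add: ballot_def)
    then have "ballot (replicate N U @ replicate M D)"
      using less.prems(4) ballot_append_U[of "[]" N] by (intro ballot_append_D) (simp_all add: cnt)
    then show ?thesis
      using less.prems(3) True
      by (intro exI[of _ "replicate N U @ replicate M D"])
        (simp add: cnt valley_counts_append_D valley_counts_replicate_U)
  next
    case False
    have finC: "finite C" using finite_strict_chain less.prems(1) .
    obtain a b where ab: "(a, b) \<in> C" and max: "\<And>c d. (c, d) \<in> C \<Longrightarrow> c \<le> a"
    proof -
      have "Max (fst ` C) \<in> fst ` C" "\<And>q. q \<in> C \<Longrightarrow> fst q \<le> Max (fst ` C)"
        using finC False by auto
      then show ?thesis using that by (metis fst_conv imageE prod.collapse)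
    qed
    have lt: "a < N" "b < M" "1 \<le> b" "b \<le> a"
      using ab less.prems(2) strict_chains_bounds[OF less.prems(1)] by auto
    obtain w where w: "ballot w" "w \<noteq> []" "last w = D" "count_list w U = a" "count_list w D = b"
      "valley_counts w = C - {(a, b)}"
    proof -
      \<comment> \<open>All other points lie strictly below the top one, so \<open>(a, b)\<close> is
        an admissible endpoint for them.\<close>
      have "c < a \<and> d < b" if "(c, d) \<in> C - {(a, b)}" for c d
        using that strict_chains_cases[OF less.prems(1) ab, of c d] max[of c d] by auto
      then show ?thesis
        using less.IH[OF lt(1) strict_chains_subset[OF less.prems(1)], of "C - {(a, b)}" b] lt that
        by blast
    qed
    \<comment> \<open>As \<open>a < N\<close> and \<open>b < M\<close>, at least one
      \<open>U\<close> creates the valley \<open>(a, b)\<close> and at least one \<open>D\<close>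
      follows.\<close>
    let ?v = "w @ replicate (N - a) U"
    have "ballot (?v @ replicate (M - b) D)"
      using w lt less.prems(4) by (intro ballot_append_D ballot_append_U) (simp_all add: cnt)
    moreover have "valley_counts (?v @ replicate (M - b) D) = C"
      using valley_counts_append_U[OF w(2,3), of "N - a"] w(4-6) lt(1) ab
      by (simp only: valley_counts_append_D zero_less_diff insert_Diff)
    moreover have "count_list (?v @ replicate (M - b) D) U = N"
        "count_list (?v @ replicate (M - b) D) D = M" "last (?v @ replicate (M - b) D) = D"
      using w lt by (simp_all add: cnt)
    ultimately show ?thesis using w(2) by blast
  qed
qed

lemma valley_counts_image_Dyck:
  assumes "n \<ge> 1"
  shows "valley_counts ` Dyck n = strict_chains n"
proof
  show "strict_chains n \<subseteq> valley_counts ` Dyck n"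
  proof
    fix C assume C: "C \<in> strict_chains n"
    have "a < n \<and> b < n" if "(a, b) \<in> C" for a b
      using strict_chains_bounds[OF C that] by simp
    from ex_ballot_with_valley_counts[OF C this assms order_refl]
    obtain w where w: "ballot w" "count_list w U = n" "count_list w D = n" "valley_counts w = C"
      by blast
    then have "w \<in> Dyck n"
      using count_U_plus_count_D[of w] by (simp add: Dyck_def ballot_def)
    then show "C \<in> valley_counts ` Dyck n" using w by blast
  qed
qed (auto intro: valley_counts_in_strict_chains)

section \<open>Transfer from chains to valley positions\<close>

lemma Dyck_complex_eq:
  assumes "n \<ge> 1"
  shows "Dyck_complex n = (`) position ` strict_chains n"
  unfolding Dyck_complex_def valley_counts_image_Dyck[OF assms, symmetric]
  by (simp add: image_image valleys_eq_position)

lemma card_valleys: "card (valleys w) = card (valley_counts w)"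
  by (simp add: valleys_eq_position card_image inj_on_subset[OF inj_position])

lemma suc_eq_card_successive:
  assumes "w \<in> Dyck n"
  shows "suc w = card (successive (valley_counts w))"
proof -
  let ?V = "valley_counts w"
  have *: "(fst (position p) - 2, snd (position p)) \<in> position ` ?V \<union> {(0, 0)} \<longleftrightarrow> p \<in> successive ?V"
    if "p \<in> ?V" for p
  proof -
    obtain a b where p: "p = (a, b)" by (cases p)
    have "1 \<le> b" "b \<le> a"
      using strict_chains_bounds[OF valley_counts_in_strict_chains[OF assms]] that p by auto
    then have "(fst (position p) - 2, snd (position p)) = position (a - 1, b - 1)"
      by (auto simp: p position_def)
    \<comment> \<open>The origin is its own position, so injectivity of \<open>position\<close> also
      covers this exceptional predecessor.\<close>
    moreover have "position ` ?V \<union> {(0, 0)} = position ` insert (0, 0) ?V"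
      by (auto simp: position_def)
    ultimately have "(fst (position p) - 2, snd (position p)) \<in> position ` ?V \<union> {(0, 0)}
        \<longleftrightarrow> (a - 1, b - 1) \<in> insert (0, 0) ?V"
      by (simp only: inj_image_mem_iff[OF inj_position])
    then show ?thesis using that by (simp add: successive_def p)
  qed
  have "{(x, y) \<in> valleys w. (x - 2, y) \<in> valleys w \<union> {(0, 0)}}
      = {q \<in> position ` ?V. (fst q - 2, snd q) \<in> position ` ?V \<union> {(0, 0)}}"
    by (simp only: valleys_eq_position case_prod_unfold prod.collapse)
  also have "\<dots> = position ` {p \<in> ?V. p \<in> successive ?V}"
    using * by blast
  also have "{p \<in> ?V. p \<in> successive ?V} = successive ?V"
    by (auto simp: successive_def)
  finally show ?thesis
    by (simp add: suc_def card_image inj_on_subset[OF inj_position])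
qed

theorem theorem3p10:
  fixes n i j :: nat and h :: "nat \<Rightarrow> nat \<Rightarrow> int"
  assumes "n \<ge> 1"
    and "is_h_triangle (Dyck_complex n) h"
    and "j \<le> i" and "i \<le> n - 1"
  shows "h i j = int (card {w \<in> Dyck_max n. card (valleys w) = i \<and> suc w = i - j})"
proof -
  let ?M = "{T. maximal_face (strict_chains n) T \<and> card T = i \<and> card (successive T) = i - j}"
  let ?W = "{w \<in> Dyck_max n. card (valleys w) = i \<and> suc w = i - j}"
  have max: "w \<in> Dyck_max n \<longleftrightarrow> w \<in> Dyck n \<and> maximal_face (strict_chains n) (valley_counts w)" for w
    by (simp add: Dyck_max_def Dyck_complex_eq[OF assms(1)] valleys_eq_position
        maximal_face_image[OF inj_position])
  have "is_h_triangle (strict_chains n) h"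
    using assms(1,2) by (simp add: Dyck_complex_eq is_h_triangle_image[OF inj_position])
  from h_triangle_unique[OF this is_h_triangle_strict_chains assms(3)]
  have "h i j = int (card ?M)"
    using assms(4) complex_rank_strict_chains[of n] by simp
  \<comment> \<open>Maximal chains are the valley sets of maximal Dyck paths, with matching
    statistics; injectivity then equates the two counts.\<close>
  also have "?M = valley_counts ` ?W"
  proof
    show "valley_counts ` ?W \<subseteq> ?M"
      by (auto simp: max card_valleys suc_eq_card_successive)
    show "?M \<subseteq> valley_counts ` ?W"
    proof
      fix T assume T: "T \<in> ?M"
      then have "T \<in> valley_counts ` Dyck n"
        by (simp add: valley_counts_image_Dyck[OF assms(1)] maximal_face_def)
      then show "T \<in> valley_counts ` ?W"
        using T by (auto simp: max card_valleys suc_eq_card_successive)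
    qed
  qed
  also have "card (valley_counts ` ?W) = card ?W"
    by (intro card_image inj_on_subset[OF inj_on_valley_counts]) (auto simp: max)
  finally show ?thesis .
qed

end
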